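(* Let $b\ge2$ be a prime number, let $d\ge1$ and $m\ge 1$ be integers, and write $m=\ell d+r$ with $\ell\in\mathbb{N}$ and $0\le r<d$. If $C^{(1)},\dots,C^{(d)}\in\mathbb{Z}_b^{m\times m}$ are all permutation matrices and $\mathcal{C}=\{C^{(1)},\dots,C^{(d)}\}$, then the smallest $t$-value $t(\mathcal{C})$ of the point set $P(\mathcal{C})$ satisfies $$t(\mathcal{C})\ \ge\ (d-2)\lfloor m/d\rfloor+r-1.$$
   Context: $\mathbb{N}=\{1,2,\dots\}$, and $\mathbb{Z}_b=\{0,1,\dots,b-1\}$ with arithmetic modulo $b$. Point set $P(\mathcal{C})$: for $h\in\mathbb{Z}_b^m$ (column vector) and $j=1,\dots,d$ let $(\delta^{(j)}_1(h),\dots,\delta^{(j)}_m(h))=C^{(j)}h\in\mathbb{Z}_b^m$ (computed modulo $b$), and let $p(h)\in[0,1)^d$ have components $p(h)_j=\sum_{k=1}^m\delta^{(j)}_k(h)\,b^{-k}$. Then $P(\mathcal{C})=(p(h))_{h\in\mathbb{Z}_b^m}$, a family of $b^m$ points counted with multiplicity. $(t,m,d)$-nets: an elementary interval in base $b$ is a set $\prod_{j=1}^d\bigl[a_jb^{-k_j},(a_j+1)b^{-k_j}\bigr)$ with integers $k_j\ge0$ and $0\le a_j<b^{k_j}$. For $0\le t\le m$, a family of $n=b^m$ points is a $(t,m,d)$-net in base $b$ if every elementary interval $E$ in base $b$ with $\sum_{j=1}^dk_j\le m-t$ contains exactly $n\cdot\mathrm{Vol}(E)$ of the points, counted with multiplicity.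 The smallest $t$-value $t(\mathcal{C})$ is the least $t\in\{0,\dots,m\}$ such that $P(\mathcal{C})$ is a $(t,m,d)$-net in base $b$. *)

theory Defs
  imports "HOL-Analysis.Analysis" "HOL-Combinatorics.Permutations" "Jordan_Normal_Form.Matrix"
begin

unbundle no vec_syntax
hide_type (open) Finite_Cartesian_Product.vec
hide_const (open) Finite_Cartesian_Product.mat Finite_Cartesian_Product.vec

text \<open>Elements of \<open>\<int>\<^sub>b\<close> are represented by the naturals in \<open>{..<b}\<close>; rows of matrices and entries
  of vectors are indexed from 0, so the \<open>k\<close>-th digit (\<open>k \<ge> 1\<close>) has index \<open>k - 1\<close>.\<close>

definition residue_vecs :: "nat \<Rightarrow> nat \<Rightarrow> nat Matrix.vec set" where
  "residue_vecs b m = {h \<in> carrier_vec m. \<forall>i<m. h $ i < b}"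

definition residue_mats :: "nat \<Rightarrow> nat \<Rightarrow> nat Matrix.mat set" where
  "residue_mats b m = {A \<in> carrier_mat m m. \<forall>i<m. \<forall>j<m. A $$ (i, j) < b}"

definition permutation_mat :: "nat \<Rightarrow> nat Matrix.mat \<Rightarrow> bool" where
  "permutation_mat m A \<longleftrightarrow>
     (\<exists>\<sigma>. \<sigma> permutes {..<m} \<and> A = Matrix.mat m m (\<lambda>(i, j). if j = \<sigma> i then 1 else 0))"

definition digits :: "nat \<Rightarrow> nat Matrix.mat \<Rightarrow> nat Matrix.vec \<Rightarrow> nat Matrix.vec" where
  "digits b A h = map_vec (\<lambda>x. x mod b) (A *\<^sub>v h)"

text \<open>Points of \<open>\<real>\<^sup>d\<close> are extensional functions on \<open>{1..d}\<close>.\<close>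

definition digital_point ::
    "nat \<Rightarrow> nat \<Rightarrow> nat \<Rightarrow> (nat \<Rightarrow> nat Matrix.mat) \<Rightarrow> nat Matrix.vec \<Rightarrow> (nat \<Rightarrow> real)" where
  "digital_point b m d C h =
     (\<lambda>j\<in>{1..d}. \<Sum>k=1..m. real (digits b (C j) h $ (k - 1)) / real b ^ k)"

definition elementary_interval ::
    "nat \<Rightarrow> nat \<Rightarrow> (nat \<Rightarrow> nat) \<Rightarrow> (nat \<Rightarrow> nat) \<Rightarrow> (nat \<Rightarrow> real) set" where
  "elementary_interval b d k a =
     (\<Pi>\<^sub>E j\<in>{1..d}. {real (a j) / real b ^ k j ..< (real (a j) + 1) / real b ^ k j})"

text \<open>A family of points counted with multiplicity is a function \<open>p\<close> on an index set \<open>I\<close>.\<close>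

definition net_in_base ::
    "nat \<Rightarrow> nat \<Rightarrow> nat \<Rightarrow> nat \<Rightarrow> 'i set \<Rightarrow> ('i \<Rightarrow> nat \<Rightarrow> real) \<Rightarrow> bool" where
  "net_in_base b t m d I p \<longleftrightarrow>
     t \<le> m \<and> finite I \<and> card I = b ^ m \<and>
     (\<forall>k a. (\<forall>j\<in>{1..d}. a j < b ^ k j) \<and> (\<Sum>j=1..d. k j) \<le> m - t \<longrightarrow>
        real (card {i \<in> I. p i \<in> elementary_interval b d k a}) =
          real (b ^ m) * measure (\<Pi>\<^sub>M j\<in>{1..d}. lborel) (elementary_interval b d k a))"

definition smallest_t_value :: "nat \<Rightarrow> nat \<Rightarrow> nat \<Rightarrow> (nat \<Rightarrow> nat Matrix.mat) \<Rightarrow> nat" where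
  "smallest_t_value b m d C =
     (LEAST t. net_in_base b t m d (residue_vecs b m) (digital_point b m d C))"

lemma measure_elementary_interval:
  assumes "b > 0"
  shows "measure (\<Pi>\<^sub>M j\<in>{1..d}. lborel) (elementary_interval b d k a) = 1 / real b ^ (\<Sum>j=1..d. k j)"
proof -
  interpret product_sigma_finite "\<lambda>_::nat. lborel :: real measure"
    by standard
  have "emeasure (\<Pi>\<^sub>M j\<in>{1..d}. lborel) (elementary_interval b d k a) =
      (\<Prod>j=1..d. emeasure lborel {real (a j) / real b ^ k j ..< (real (a j) + 1) / real b ^ k j})"
    unfolding elementary_interval_def by (rule emeasure_PiM) auto
  also have "\<dots> = (\<Prod>j=1..d. ennreal (1 / real b ^ k j))"
    using assms by (intro prod.cong) (auto simp: divide_right_mono add_divide_distrib)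
  also have "\<dots> = ennreal (1 / real b ^ (\<Sum>j=1..d. k j))"
    by (subst prod_ennreal) (auto simp: prod_dividef power_sum)
  finally show ?thesis
    by (simp add: measure_def)
qed

lemma card_residue_vecs: "finite (residue_vecs b m)" "card (residue_vecs b m) = b ^ m"
proof -
  have bij: "bij_betw (\<lambda>f. Matrix.vec m f) ({..<m} \<rightarrow>\<^sub>E {..<b}) (residue_vecs b m)"
    by (rule bij_betw_byWitness[where f' = "\<lambda>v. \<lambda>i\<in>{..<m}. v $ i"])
       (auto simp: residue_vecs_def fun_eq_iff PiE_def extensional_def)
  show "finite (residue_vecs b m)"
    using bij_betw_finite[OF bij] by (simp add: finite_PiE)
  show "card (residue_vecs b m) = b ^ m"
    using bij_betw_same_card[OF bij] by (simp add: card_PiE)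
qed

lemma digit_sum_less_1:
  assumes "b > 0" "\<And>k. k \<in> {1..m} \<Longrightarrow> x k < b"
  shows "(\<Sum>k=1..m. real (x k) / real b ^ k) < 1"
proof -
  have "(\<Sum>k=1..m. real (x k) / real b ^ k) \<le> 1 - 1 / real b ^ m"
    using assms(2)
  proof (induction m)
    case (Suc m)
    have "real (x (Suc m)) \<le> real b - 1"
      using Suc.prems[of "Suc m"] by simp
    then have "real (x (Suc m)) / real b ^ Suc m \<le> (real b - 1) / real b ^ Suc m"
      by (intro divide_right_mono) auto
    also have "\<dots> = 1 / real b ^ m - 1 / real b ^ Suc m"
      using \<open>b > 0\<close> by (simp add: field_simps)
    finally show ?case using Suc by simp
  qed simp
  also have "\<dots> < 1" using \<open>b > 0\<close> by simp
  finally show ?thesis .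
qed

text \<open>The minimum defining the smallest \<open>t\<close>-value is attained.\<close>

lemma net_in_base_trivial:
  assumes "b > 0" "\<And>j. j \<in> {1..d} \<Longrightarrow> C j \<in> carrier_mat m m"
  shows "net_in_base b m m d (residue_vecs b m) (digital_point b m d C)"
proof -
  have "digital_point b m d C h \<in> elementary_interval b d k a"
    if "h \<in> residue_vecs b m" "\<forall>j\<in>{1..d}. a j < b ^ k j" "(\<Sum>j=1..d. k j) = 0" for h k a
  proof -
    have k: "k j = 0" if "j \<in> {1..d}" for j
      using that \<open>(\<Sum>j=1..d. k j) = 0\<close> by simp
    have a: "a j = 0" if "j \<in> {1..d}" for j
      using \<open>\<forall>j\<in>{1..d}. a j < b ^ k j\<close> that k by force
    have "digits b (C j) h $ (i - 1) < b" if "j \<in> {1..d}" "i \<in> {1..m}" for i j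
      using assms(1) assms(2)[OF that(1)] that(2) by (auto simp: digits_def)
    then show ?thesis
      using digit_sum_less_1[OF assms(1)]
      by (auto simp: digital_point_def elementary_interval_def k a intro!: sum_nonneg)
  qed
  then have "{h \<in> residue_vecs b m. digital_point b m d C h \<in> elementary_interval b d k a}
      = residue_vecs b m" if "\<forall>j\<in>{1..d}. a j < b ^ k j" "(\<Sum>j=1..d. k j) = 0" for k a
    using that by blast
  then show ?thesis
    unfolding net_in_base_def measure_elementary_interval[OF assms(1)]
    by (simp add: card_residue_vecs del: sum_eq_0_iff)
qed

lemma smallest_t_value_net:
  assumes "b > 0" "\<And>j. j \<in> {1..d} \<Longrightarrow> C j \<in> carrier_mat m m"
  shows "net_in_base b (smallest_t_value b m d C) m d (residue_vecs b m) (digital_point b m d C)"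
  unfolding smallest_t_value_def by (rule LeastI) (rule net_in_base_trivial[OF assms])

end

theory Submission
  imports Defs
begin

text \<open>For \<open>C j\<close> the matrix of a permutation \<open>\<sigma>\<^sub>j\<close>, the \<open>k\<close>-th digit of the \<open>j\<close>-th coordinate of
  \<open>p(h)\<close> is the entry of \<open>h\<close> at \<open>\<sigma>\<^sub>j(k)\<close>. The first \<open>l + 1\<close> digits in each of the \<open>d\<close> coordinates
  are \<open>d(l + 1) > m\<close> entries of \<open>h\<close>, so two of them coincide: the \<open>p\<close>-th digit of coordinate \<open>i\<close>
  and the \<open>q\<close>-th digit of coordinate \<open>j \<noteq> i\<close>. An elementary interval of order \<open>p + q \<le> 2l + 2\<close> that
  prescribes different values for these two digits contains no point, so \<open>m - t < 2l + 2\<close>.\<close>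

text \<open>The net property enters the lower bound through this consequence: the prescribed count
  is \<open>b ^ m\<close> times a positive volume.\<close>

lemma net_in_base_elementary_interval_nonempty:
  assumes "net_in_base b t m d I p" and "b > 0"
    and "\<And>j. j \<in> {1..d} \<Longrightarrow> a j < b ^ k j" and "(\<Sum>j=1..d. k j) \<le> m - t"
  obtains i where "i \<in> I" "p i \<in> elementary_interval b d k a"
proof -
  have "real (card {i \<in> I. p i \<in> elementary_interval b d k a}) =
      real (b ^ m) * measure (\<Pi>\<^sub>M j\<in>{1..d}. lborel) (elementary_interval b d k a)"
    using assms unfolding net_in_base_def by blast
  also have "\<dots> > 0"
    unfolding measure_elementary_interval[OF \<open>b > 0\<close>] using \<open>b > 0\<close> by simp
  finally have "{i \<in> I. p i \<in> elementary_interval b d k a} \<noteq> {}"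
    by (metis card.empty of_nat_0 less_irrefl)
  then show ?thesis using that by blast
qed

text \<open>Row \<open>i\<close> of \<open>A\<close> has its single 1 in column
  \<open>\<sigma> i\<close>, and reduction modulo \<open>b\<close> fixes the entries of
  \<open>h\<close>.\<close>

lemma digits_permutation_mat:
  assumes "permutation_mat m A"
  obtains \<sigma> where "\<sigma> permutes {..<m}"
    and "\<And>b h i. h \<in> residue_vecs b m \<Longrightarrow> i < m \<Longrightarrow> digits b A h $ i = h $ \<sigma> i"
proof -
  obtain \<sigma> where \<sigma>: "\<sigma> permutes {..<m}"
    and A: "A = Matrix.mat m m (\<lambda>(i, j). if j = \<sigma> i then 1 else 0)"
    using assms unfolding permutation_mat_def by blast
  have "digits b A h $ i = h $ \<sigma> i" if h: "h \<in> residue_vecs b m" and i: "i < m" for b h i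
  proof -
    have \<sigma>i: "\<sigma> i < m"
      using permutes_in_image[OF \<sigma>, of i] i by simp
    have "dim_vec h = m"
      using h by (auto simp: residue_vecs_def)
    then have "(A *\<^sub>v h) $ i = (\<Sum>j = 0..<m. (if j = \<sigma> i then 1 else 0) * h $ j)"
      using i by (auto simp: A scalar_prod_def intro!: sum.cong)
    also have "\<dots> = (\<Sum>j = 0..<m. if j = \<sigma> i then h $ j else 0)"
      by (intro sum.cong) auto
    also have "\<dots> = h $ \<sigma> i"
      using \<sigma>i by simp
    finally show ?thesis
      using h i \<sigma>i by (simp add: digits_def residue_vecs_def A)
  qed
  then show ?thesis using \<sigma> that by blast
qed

lemma digit_sum_ge_digit:
  assumes "q \<in> {1..m}"
  shows "real (x q) / real b ^ q \<le> (\<Sum>k=1..m. real (x k) / real b ^ k)"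
  using assms by (intro member_le_sum) auto

text \<open>The two bounds describe the numbers whose first \<open>q\<close> digits are 0, ..., 0,
  1. A nonzero digit before position \<open>q\<close> would make the sum too large, and zeros up to
  position \<open>q\<close> would make it too small.\<close>

lemma leading_digit_nonzero:
  assumes "b \<ge> 2" and "q \<in> {1..m}" and "\<And>k. k \<in> {1..m} \<Longrightarrow> x k < b"
    and "1 / real b ^ q \<le> (\<Sum>k=1..m. real (x k) / real b ^ k)"
    and "(\<Sum>k=1..m. real (x k) / real b ^ k) < 2 / real b ^ q"
  shows "x q \<noteq> 0"
proof
  have "b > 0"
    using \<open>b \<ge> 2\<close> by simp
  assume "x q = 0"
  have zero: "x k = 0" if "k \<in> {1..q}" for k
  proof (rule ccontr)
    assume "x k \<noteq> 0"
    with \<open>x q = 0\<close> that have "k < q"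
      by (cases "k = q") auto
    \<comment> \<open>Since \<open>k < q\<close> and \<open>b \<ge> 2\<close>, the digit at
      \<open>k\<close> alone contributes at least the excluded upper bound
      \<open>2 / b ^ q\<close>.\<close>
    have "2 * real b ^ k \<le> real b * real b ^ k"
      using \<open>b \<ge> 2\<close> by (intro mult_right_mono) auto
    also have "\<dots> \<le> real b ^ q"
      using \<open>b > 0\<close> \<open>k < q\<close> by (metis Suc_leI of_nat_1 of_nat_le_iff One_nat_def power_Suc power_increasing)
    finally have "2 / real b ^ q \<le> 1 / real b ^ k"
      using \<open>b > 0\<close> by (simp add: field_simps)
    also have "\<dots> \<le> real (x k) / real b ^ k"
      using \<open>x k \<noteq> 0\<close> by (intro divide_right_mono) auto
    also have "\<dots> \<le> (\<Sum>k=1..m. real (x k) / real b ^ k)"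
      using \<open>q \<in> {1..m}\<close> that by (intro digit_sum_ge_digit) auto
    finally show False using assms(5) by simp
  qed
  \<comment> \<open>Only the tail remains. It is \<open>1 / b ^ q\<close> times a digit sum below 1;
    the bounds are written to match the index shift by \<open>q\<close>.\<close>
  have "(\<Sum>k=1..m. real (x k) / real b ^ k) = (\<Sum>k=1+q..(m-q)+q. real (x k) / real b ^ k)"
    using \<open>q \<in> {1..m}\<close> zero by (intro sum.mono_neutral_right) auto
  also have "\<dots> = (\<Sum>k=1..m-q. real (x (k + q)) / real b ^ (k + q))"
    by (rule sum.shift_bounds_cl_nat_ivl)
  also have "\<dots> = (\<Sum>k=1..m-q. real (x (k + q)) / real b ^ k) / real b ^ q"
    by (simp add: sum_divide_distrib power_add)
  also have "\<dots> < 1 / real b ^ q"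
    using assms(3) \<open>b > 0\<close> by (intro divide_strict_right_mono digit_sum_less_1) auto
  finally show False using assms(4) by simp
qed

text \<open>Pigeonhole: \<open>d * n\<close> pairs are mapped into \<open>m\<close> values, where
  \<open>n \<le> m\<close> keeps every position inside the permuted set. Injectivity of each
  \<open>\<sigma> i\<close> forces a collision to involve two different coordinates.\<close>

lemma permutation_families_collision:
  fixes \<sigma> :: "nat \<Rightarrow> nat \<Rightarrow> nat" and d n m :: nat
  assumes "\<And>j. j \<in> {1..d} \<Longrightarrow> \<sigma> j permutes {..<m}" and "n \<le> m" and "m < d * n"
  obtains i j p q where "i \<in> {1..d}" "j \<in> {1..d}" "i \<noteq> j" "p < n" "q < n" "\<sigma> i p = \<sigma> j q"
proof -
  let ?f = "\<lambda>(j, p). \<sigma> j p"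
  have "?f ` ({1..d} \<times> {..<n}) \<subseteq> {..<m}"
  proof clarify
    fix j p assume "j \<in> {1..d}" "p < n"
    then show "\<sigma> j p < m"
      using permutes_in_image[OF assms(1)[OF \<open>j \<in> {1..d}\<close>], of p] \<open>n \<le> m\<close> by auto
  qed
  then have "card (?f ` ({1..d} \<times> {..<n})) \<le> m"
    using card_mono[of "{..<m}"] by fastforce
  then have "\<not> inj_on ?f ({1..d} \<times> {..<n})"
    using \<open>m < d * n\<close> by (auto dest: card_image simp: card_cartesian_product)
  then obtain i j p q where "i \<in> {1..d}" "j \<in> {1..d}" "p < n" "q < n" "\<sigma> i p = \<sigma> j q"
    and ne: "(i, p) \<noteq> (j, q)"
    unfolding inj_on_def by force
  moreover have "i \<noteq> j"
    using ne \<open>\<sigma> i p = \<sigma> j q\<close> permutes_inj[OF assms(1)[OF \<open>i \<in> {1..d}\<close>]] by (auto dest: injD)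
  ultimately show ?thesis using that by blast
qed

lemma equal_digits_not_net:
  assumes net: "net_in_base b t m d (residue_vecs b m) (digital_point b m d C)"
    and "b \<ge> 2" and ij: "i \<in> {1..d}" "j \<in> {1..d}" "i \<noteq> j" and pq: "p < m" "q < m"
    and carrier: "C i \<in> carrier_mat m m"
    and eq: "\<And>h. h \<in> residue_vecs b m \<Longrightarrow> digits b (C i) h $ p = digits b (C j) h $ q"
  shows "m - t < p + q + 2"
proof (rule ccontr)
  assume "\<not> m - t < p + q + 2"
  \<comment> \<open>This interval fixes the first \<open>p + 1\<close> digits of coordinate
    \<open>i\<close> as 0, ..., 0, 1 and the first \<open>q + 1\<close> digits of coordinate
    \<open>j\<close> as zeros; all other coordinates are free. Since \<open>p\<close> and
    \<open>q\<close> count from 0, its order is \<open>p + q + 2\<close>.\<close>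
  define k where "k = (\<lambda>n. if n = i then Suc p else if n = j then Suc q else 0)"
  define a :: "nat \<Rightarrow> nat" where "a = (\<lambda>n. if n = i then 1 else 0)"
  have "(\<Sum>n=1..d. k n) = (\<Sum>n\<in>{i, j}. k n)"
    using ij by (intro sum.mono_neutral_right) (auto simp: k_def)
  also have "\<dots> = p + q + 2"
    using ij by (simp add: k_def)
  finally have k: "(\<Sum>n=1..d. k n) \<le> m - t"
    using \<open>\<not> m - t < p + q + 2\<close> by simp
  have "1 < b ^ Suc p"
    using \<open>b \<ge> 2\<close> by (intro one_less_power) auto
  then have a: "a n < b ^ k n" for n
    using \<open>b \<ge> 2\<close> by (auto simp: a_def k_def)
  obtain h where h: "h \<in> residue_vecs b m"
    and hE: "digital_point b m d C h \<in> elementary_interval b d k a"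
    using net_in_base_elementary_interval_nonempty[OF net _ a k] \<open>b \<ge> 2\<close> by auto
  let ?x = "\<lambda>n s. digits b (C n) h $ (s - 1)"
  have mem: "(\<Sum>s=1..m. real (?x n s) / real b ^ s) \<in>
      {real (a n) / real b ^ k n ..< (real (a n) + 1) / real b ^ k n}" if "n \<in> {1..d}" for n
    using hE that by (auto simp: elementary_interval_def digital_point_def PiE_iff)
  have "real (?x j (Suc q)) / real b ^ Suc q \<le> (\<Sum>s=1..m. real (?x j s) / real b ^ s)"
    using \<open>q < m\<close> by (intro digit_sum_ge_digit) auto
  also have "\<dots> < 1 / real b ^ Suc q"
    using mem[OF ij(2)] ij by (simp add: a_def k_def)
  finally have "digits b (C j) h $ q = 0"
    using \<open>b \<ge> 2\<close> by (simp add: divide_less_cancel)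
  moreover have "?x i (Suc p) \<noteq> 0"
  proof (rule leading_digit_nonzero[of b "Suc p" m "?x i"])
    show "?x i s < b" if "s \<in> {1..m}" for s
      using that carrier \<open>b \<ge> 2\<close> by (auto simp: digits_def)
  qed (use mem[OF ij(1)] \<open>b \<ge> 2\<close> \<open>p < m\<close> in \<open>auto simp: a_def k_def\<close>)
  ultimately show False
    using eq[OF h] by simp
qed

theorem corollary4:
  fixes b d m l r :: nat
    and C :: "nat \<Rightarrow> nat Matrix.mat"
  assumes "prime b" and "b \<ge> 2" and "d \<ge> 1" and "m \<ge> 1"
    and "m = l * d + r" and "l \<ge> 1" and "r < d"
    and "\<And>j. j \<in> {1..d} \<Longrightarrow> C j \<in> residue_mats b m"
    and "\<And>j. j \<in> {1..d} \<Longrightarrow> permutation_mat m (C j)"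
  shows "int (smallest_t_value b m d C) \<ge> (int d - 2) * \<lfloor>real m / real d\<rfloor> + int r - 1"
proof -
  let ?t = "smallest_t_value b m d C"
  have floor: "\<lfloor>real m / real d\<rfloor> = int l"
    unfolding floor_divide_of_nat_eq using assms(5,7) by simp
  show ?thesis
  \<comment> \<open>With a single coordinate there is no collision to find, but then
    \<open>r = 0\<close> and the claimed bound \<open>- l - 1\<close> is negative.\<close>
  proof (cases "d = 1")
    case True
    then show ?thesis using assms(7) floor by simp
  next
    case False
    then have "d \<ge> 2" using assms(3) by simp
    have carrier: "C j \<in> carrier_mat m m" if "j \<in> {1..d}" for j
      using assms(8)[OF that] by (simp add: residue_mats_def)
    have net: "net_in_base b ?t m d (residue_vecs b m) (digital_point b m d C)"
      using \<open>b \<ge> 2\<close> carrier by (intro smallest_t_value_net) auto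
    have "\<exists>\<sigma>. \<sigma> permutes {..<m} \<and>
        (\<forall>h\<in>residue_vecs b m. \<forall>i<m. digits b (C j) h $ i = h $ \<sigma> i)" if "j \<in> {1..d}" for j
      using digits_permutation_mat[OF assms(9)[OF that]] by metis
    then obtain \<sigma> where \<sigma>: "\<And>j. j \<in> {1..d} \<Longrightarrow> \<sigma> j permutes {..<m}"
      and digits: "\<And>j h i. j \<in> {1..d} \<Longrightarrow> h \<in> residue_vecs b m \<Longrightarrow> i < m \<Longrightarrow>
        digits b (C j) h $ i = h $ \<sigma> j i"
      by metis
    \<comment> \<open>As \<open>l \<ge> 1\<close>, this gives
      \<open>l + 1 \<le> 2 * l \<le> m\<close>, so each coordinate has \<open>l + 1\<close>
      digits.\<close>
    have "l * 2 \<le> l * d"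
      using \<open>d \<ge> 2\<close> by simp
    then have "l + 1 \<le> m"
      using assms(5,6) by linarith
    moreover have "m < d * (l + 1)"
      using assms(5,7) by (simp add: algebra_simps)
    ultimately obtain i j p q where ij: "i \<in> {1..d}" "j \<in> {1..d}" "i \<noteq> j"
      and pq: "p < l + 1" "q < l + 1" and eq: "\<sigma> i p = \<sigma> j q"
      using permutation_families_collision[of d \<sigma> m "l + 1"] \<sigma> by blast
    have "p < m" "q < m"
      using pq \<open>l + 1 \<le> m\<close> by auto
    then have "m - ?t < p + q + 2"
      using digits eq ij by (intro equal_digits_not_net[OF net \<open>b \<ge> 2\<close> ij _ _ carrier]) auto
    \<comment> \<open>Here \<open>p\<close> and \<open>q\<close> are at most \<open>l\<close>;
      substituting \<open>m = l * d + r\<close> then yields the bound.\<close>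
    then have "int m \<le> int ?t + 2 * int l + 1"
      using pq by linarith
    then show ?thesis
      unfolding floor using assms(5) by (simp add: algebra_simps)
  qed
qed

end
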